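(* Let $R$ be a unital, non-associative ring, $\sigma$ an automorphism of $R$ and $\delta$ a $\sigma$-derivation on $R$. If $R$ is right Noetherian, then $R[X;\sigma,\delta]$ is right Noetherian; and if $R$ is left Noetherian, then $R[X;\sigma,\delta]$ is left Noetherian.
   Context: "Non-associative" means not necessarily associative. A non-associative ring is an abelian group with a biadditive multiplication; it is unital if there is an element $1$ with $1\cdot a=a\cdot 1=a$ for all $a$. An endomorphism of $R$ is an additive, multiplicative map $R\to R$; it is unital if it maps $1$ to $1$; an automorphism is a bijective endomorphism. For a unital endomorphism $\sigma$, a $\sigma$-derivation is an additive map $\delta\colon R\to R$ with $\delta(a\cdot b)=\sigma(a)\cdot\delta(b)+\delta(a)\cdot b$ for all $a,b\in R$. The unital, non-associative Ore extension $R[X;\sigma,\delta]$ is the set of formal sums $\sum_{i\in\mathbb{N}}a_iX^i$ ($\mathbb{N}=\{0,1,2,\dots\}$) with finitely many nonzero $a_i\in R$, with coefficientwise equality and addition, and with multiplication the biadditive extension of $aX^m\cdot bX^n=\sum_{i\in\mathbb{N}}(a\cdot\pi_i^m(b))X^{i+n}$, where $\pi_i^m\colon R\to R$ is the sum of all $\binom{m}{i}$ compositions of $i$ copies of $\sigma$ and $m-i$ copies of $\delta$ in arbitrary order, $\pi_0^0=\mathrm{id}_R$, and $\pi_i^m=0$ if $i<0$ or $i>m$. A right (left) ideal of a non-associative ring $S$ is an additive subgroup $I$ with $i\cdot s\in I$ ($s\cdot i\in I$) for all $i\in I$, $s\in S$. $S$ is right (left) Noetherian if it satisfies the ascending chain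 condition on right (left) ideals. *)

theory Defs
  imports "HOL-Algebra.AbelCoset" "HOL-Algebra.UnivPoly"
begin

text \<open>
  Rings here are not assumed associative, so the locale \<^locale>\<open>ring\<close> of the library is
  replaced by \<open>nonassoc_ring\<close> below, on the same record type \<^typ>\<open>('a, 'm) ring_scheme\<close>.
  The zero ring is allowed.
\<close>

locale nonassoc_ring = abelian_group R for R (structure) +
  assumes m_closed: "\<lbrakk>x \<in> carrier R; y \<in> carrier R\<rbrakk> \<Longrightarrow> x \<otimes> y \<in> carrier R"
    and l_distr: "\<lbrakk>x \<in> carrier R; y \<in> carrier R; z \<in> carrier R\<rbrakk>
      \<Longrightarrow> (x \<oplus> y) \<otimes> z = x \<otimes> z \<oplus> y \<otimes> z"
    and r_distr: "\<lbrakk>x \<in> carrier R; y \<in> carrier R; z \<in> carrier R\<rbrakk>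
      \<Longrightarrow> z \<otimes> (x \<oplus> y) = z \<otimes> x \<oplus> z \<otimes> y"

locale unital_nonassoc_ring = nonassoc_ring +
  assumes one_closed: "\<one> \<in> carrier R"
    and l_one: "x \<in> carrier R \<Longrightarrow> \<one> \<otimes> x = x"
    and r_one: "x \<in> carrier R \<Longrightarrow> x \<otimes> \<one> = x"


text \<open>
  Endomorphisms are not required to preserve the unit, unlike elements of \<^const>\<open>ring_hom\<close>.
  A bijective one does so automatically.
\<close>

definition ring_endomorphism :: "('a, 'm) ring_scheme \<Rightarrow> ('a \<Rightarrow> 'a) \<Rightarrow> bool"
  where "ring_endomorphism R f \<longleftrightarrow>
    f \<in> carrier R \<rightarrow> carrier R \<and>
    (\<forall>a \<in> carrier R. \<forall>b \<in> carrier R. f (a \<oplus>\<^bsub>R\<^esub> b) = f a \<oplus>\<^bsub>R\<^esub> f b) \<and>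
    (\<forall>a \<in> carrier R. \<forall>b \<in> carrier R. f (a \<otimes>\<^bsub>R\<^esub> b) = f a \<otimes>\<^bsub>R\<^esub> f b)"

definition ring_automorphism :: "('a, 'm) ring_scheme \<Rightarrow> ('a \<Rightarrow> 'a) \<Rightarrow> bool"
  where "ring_automorphism R f \<longleftrightarrow>
    ring_endomorphism R f \<and> bij_betw f (carrier R) (carrier R)"

lemma (in unital_nonassoc_ring) ring_automorphism_one:
  assumes "ring_automorphism R f"
  shows "f \<one> = \<one>"
proof -
  have bij: "bij_betw f (carrier R) (carrier R)"
    and mult: "\<And>a b. \<lbrakk>a \<in> carrier R; b \<in> carrier R\<rbrakk> \<Longrightarrow> f (a \<otimes> b) = f a \<otimes> f b"
    using assms by (auto simp: ring_automorphism_def ring_endomorphism_def)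
  obtain e where e: "e \<in> carrier R" "f e = \<one>"
    using bij one_closed by (metis bij_betw_iff_bijections)
  have f1: "f \<one> \<in> carrier R"
    using bij one_closed by (metis bij_betwE)
  have "f \<one> = f \<one> \<otimes> f e"
    using f1 e by (simp add: r_one)
  also have "\<dots> = f (\<one> \<otimes> e)"
    using mult one_closed e by simp
  also have "\<dots> = \<one>"
    using e by (simp add: l_one)
  finally show ?thesis .
qed

definition sigma_derivation :: "('a, 'm) ring_scheme \<Rightarrow> ('a \<Rightarrow> 'a) \<Rightarrow> ('a \<Rightarrow> 'a) \<Rightarrow> bool"
  where "sigma_derivation R \<sigma> \<delta> \<longleftrightarrow>
    \<delta> \<in> carrier R \<rightarrow> carrier R \<and>
    (\<forall>a \<in> carrier R. \<forall>b \<in> carrier R. \<delta> (a \<oplus>\<^bsub>R\<^esub> b) = \<delta> a \<oplus>\<^bsub>R\<^esub> \<delta> b) \<and>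
    (\<forall>a \<in> carrier R. \<forall>b \<in> carrier R.
      \<delta> (a \<otimes>\<^bsub>R\<^esub> b) = \<sigma> a \<otimes>\<^bsub>R\<^esub> \<delta> b \<oplus>\<^bsub>R\<^esub> \<delta> a \<otimes>\<^bsub>R\<^esub> b)"


text \<open>
  The map $\pi_i^m$. The words \<open>w\<close> of length \<open>m\<close> with exactly \<open>i\<close> letters \<^const>\<open>True\<close> index the
  compositions of \<open>i\<close> copies of \<open>\<sigma>\<close> and \<open>m - i\<close> copies of \<open>\<delta>\<close>; indexing by words rather than by
  the resulting maps keeps the multiplicities, so that there are always \<open>m choose i\<close> summands.
\<close>

definition ore_pi ::
    "('a, 'm) ring_scheme \<Rightarrow> ('a \<Rightarrow> 'a) \<Rightarrow> ('a \<Rightarrow> 'a) \<Rightarrow> nat \<Rightarrow> nat \<Rightarrow> 'a \<Rightarrow> 'a"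
  where "ore_pi R \<sigma> \<delta> m i b =
    (\<Oplus>\<^bsub>R\<^esub>w \<in> {w :: bool list. length w = m \<and> count_list w True = i}.
      foldr (\<lambda>s. if s then \<sigma> else \<delta>) w b)"

text \<open>
  A formal sum $\sum_i a_i X^i$ is represented by its coefficient function, an element of
  \<^term>\<open>up R\<close>. The following is the coefficient function of
  $a X^m \cdot b X^n = \sum_i (a \cdot \pi_i^m(b)) X^{i+n}$: the coefficient at \<open>k\<close> is the summand
  with \<open>i + n = k\<close>.
\<close>

definition ore_monom_mult ::
    "('a, 'm) ring_scheme \<Rightarrow> ('a \<Rightarrow> 'a) \<Rightarrow> ('a \<Rightarrow> 'a) \<Rightarrow> 'a \<Rightarrow> nat \<Rightarrow> 'a \<Rightarrow> nat \<Rightarrow> nat \<Rightarrow> 'a"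
  where "ore_monom_mult R \<sigma> \<delta> a m b n =
    (\<lambda>k. if n \<le> k then a \<otimes>\<^bsub>R\<^esub> ore_pi R \<sigma> \<delta> m (k - n) b else \<zero>\<^bsub>R\<^esub>)"

definition ore_extension ::
    "('a, 'm) ring_scheme \<Rightarrow> ('a \<Rightarrow> 'a) \<Rightarrow> ('a \<Rightarrow> 'a) \<Rightarrow> (nat \<Rightarrow> 'a) ring"
  where "ore_extension R \<sigma> \<delta> =
    \<lparr>carrier = up R,
     monoid.mult = (\<lambda>p q k. \<Oplus>\<^bsub>R\<^esub>m \<in> {m. p m \<noteq> \<zero>\<^bsub>R\<^esub>}. \<Oplus>\<^bsub>R\<^esub>n \<in> {n. q n \<noteq> \<zero>\<^bsub>R\<^esub>}.
       ore_monom_mult R \<sigma> \<delta> (p m) m (q n) n k),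
     one = (\<lambda>k. if k = 0 then \<one>\<^bsub>R\<^esub> else \<zero>\<^bsub>R\<^esub>),
     zero = (\<lambda>k. \<zero>\<^bsub>R\<^esub>),
     add = (\<lambda>p q k. p k \<oplus>\<^bsub>R\<^esub> q k)\<rparr>"


definition right_ideal :: "'a set \<Rightarrow> ('a, 'm) ring_scheme \<Rightarrow> bool"
  where "right_ideal I S \<longleftrightarrow>
    additive_subgroup I S \<and> (\<forall>i \<in> I. \<forall>s \<in> carrier S. i \<otimes>\<^bsub>S\<^esub> s \<in> I)"

definition left_ideal :: "'a set \<Rightarrow> ('a, 'm) ring_scheme \<Rightarrow> bool"
  where "left_ideal I S \<longleftrightarrow>
    additive_subgroup I S \<and> (\<forall>i \<in> I. \<forall>s \<in> carrier S. s \<otimes>\<^bsub>S\<^esub> i \<in> I)"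

definition right_noetherian :: "('a, 'm) ring_scheme \<Rightarrow> bool"
  where "right_noetherian S \<longleftrightarrow>
    (\<forall>C :: nat \<Rightarrow> 'a set. (\<forall>n. right_ideal (C n) S) \<and> (\<forall>n. C n \<subseteq> C (Suc n))
      \<longrightarrow> (\<exists>N. \<forall>n \<ge> N. C n = C N))"

definition left_noetherian :: "('a, 'm) ring_scheme \<Rightarrow> bool"
  where "left_noetherian S \<longleftrightarrow>
    (\<forall>C :: nat \<Rightarrow> 'a set. (\<forall>n. left_ideal (C n) S) \<and> (\<forall>n. C n \<subseteq> C (Suc n))
      \<longrightarrow> (\<exists>N. \<forall>n \<ge> N. C n = C N))"

end

theory Submission
  imports Defs
begin

text \<open>
  For an additive subgroup \<open>I\<close> of the Ore extension, let \<open>L\<^sub>n(I)\<close> be the set of coefficients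
  of \<open>X\<^sup>n\<close> of the elements of \<open>I\<close> of degree at most \<open>n\<close>. Nested subgroups with the same
  \<open>L\<^sub>n\<close> for every \<open>n\<close> are equal. Since \<open>\<sigma>\<close> is bijective and the leading coefficient of \<open>pq\<close> is
  \<open>a \<sigma>\<^sup>m(b)\<close>, the sets \<open>L\<^sub>n(I)\<close> (for a right ideal \<open>I\<close>), respectively \<open>\<sigma>\<^sup>-\<^sup>n(L\<^sub>n(I))\<close>
  (for a left ideal \<open>I\<close>), are ideals of \<open>R\<close> of the same side and increase with \<open>n\<close>, because
  \<open>I\<close> is closed under multiplication by \<open>X\<close>. So a chain of ideals of the Ore extension yields
  a doubly increasing family of ideals of \<open>R\<close>, which stabilises uniformly. No associativity enters, as
  only products of two elements occur.
\<close>

section \<open>Stabilisation of doubly increasing families\<close>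

text \<open>
  The diagonal settles all large \<open>n\<close> at once, and finitely many rows remain.
\<close>

lemma double_chain_stabilises:
  fixes M :: "nat \<Rightarrow> nat \<Rightarrow> 'b set"
  assumes acc: "\<And>C :: nat \<Rightarrow> 'b set. (\<And>n. P (C n)) \<Longrightarrow> (\<And>n. C n \<subseteq> C (Suc n))
      \<Longrightarrow> \<exists>N. \<forall>n \<ge> N. C n = C N"
    and P: "\<And>k n. P (M k n)"
    and step1: "\<And>k n. M k n \<subseteq> M (Suc k) n"
    and step2: "\<And>k n. M k n \<subseteq> M k (Suc n)"
  shows "\<exists>N. \<forall>k \<ge> N. \<forall>n. M k n = M N n"
proof -
  have mono1: "M k n \<subseteq> M k' n" if "k \<le> k'" for k k' n
    using that by (rule lift_Suc_mono_le[of "\<lambda>k. M k n", OF step1])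
  have mono2: "M k n \<subseteq> M k n'" if "n \<le> n'" for k n n'
    using that by (rule lift_Suc_mono_le[of "M k", OF step2])
  obtain K where K: "\<And>k. k \<ge> K \<Longrightarrow> M k k = M K K"
    using acc[of "\<lambda>k. M k k"] P step1 step2 by blast
  \<comment> \<open>The set is squeezed between \<open>M K K\<close> and the diagonal set at
    \<open>max k n\<close>, which equals \<open>M K K\<close> by the choice of
    \<open>K\<close>.\<close>
  have diag: "M k n = M K K" if "k \<ge> K" "n \<ge> K" for k n
  proof
    have "M k n \<subseteq> M (max k n) (max k n)"
      using mono1[of k "max k n"] mono2[of n "max k n"] by fastforce
    then show "M k n \<subseteq> M K K"
      using K[of "max k n"] that by simp
    show "M K K \<subseteq> M k n"
      using mono1[of K k K] mono2[of K n k] that by blast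
  qed
  have "\<exists>N. \<forall>k \<ge> N. M k n = M N n" for n
    using acc[of "\<lambda>k. M k n"] P step1 by blast
  then obtain N where N: "\<And>n k. k \<ge> N n \<Longrightarrow> M k n = M (N n) n"
    by metis
  \<comment> \<open>Only the finitely many \<open>n < K\<close> need thresholds of their own.
    Inserting \<open>K\<close> gives \<open>K \<le> B\<close>, as \<open>diag\<close> requires, and
    keeps the set nonempty when \<open>K = 0\<close>.\<close>
  define B where "B = Max (insert K (N ` {..<K}))"
  have BK: "K \<le> B" and BN: "\<And>n. n < K \<Longrightarrow> N n \<le> B"
    by (auto simp: B_def)
  have "M k n = M B n" if "k \<ge> B" for k n
  proof (cases "n < K")
    case True
    then show ?thesis using N BN that by (metis order_trans)
  next
    case False
    then show ?thesis using diag BK that by (metis linorder_not_le order_trans)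
  qed
  then show ?thesis by blast
qed

section \<open>Leading coefficients and multiplication by zero\<close>

text \<open>With degree at most \<open>n\<close> instead of exactly \<open>n\<close>, zero belongs
  to the set and a sum whose top terms cancel stays in it.\<close>

definition leading_coeffs :: "('a, 'm) ring_scheme \<Rightarrow> (nat \<Rightarrow> 'a) set \<Rightarrow> nat \<Rightarrow> 'a set"
  where "leading_coeffs R I n = {p n | p. p \<in> I \<and> (\<forall>m > n. p m = \<zero>\<^bsub>R\<^esub>)}"

lemma leading_coeffs_mono: "I \<subseteq> J \<Longrightarrow> leading_coeffs R I n \<subseteq> leading_coeffs R J n"
  by (auto simp: leading_coeffs_def)

lemma (in abelian_group) add_idem_zero:
  assumes "a \<in> carrier G" "a \<oplus> a = a"
  shows "a = \<zero>"
  using assms add.l_cancel_one[of a a] by simp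

lemma (in nonassoc_ring) r_null: "x \<in> carrier R \<Longrightarrow> x \<otimes> \<zero> = \<zero>"
  using r_distr[of \<zero> \<zero> x] by (intro add_idem_zero) (simp_all add: m_closed)

lemma (in nonassoc_ring) l_null: "x \<in> carrier R \<Longrightarrow> \<zero> \<otimes> x = \<zero>"
  using l_distr[of \<zero> \<zero> x] by (intro add_idem_zero) (simp_all add: m_closed)

section \<open>Powers of \<open>\<sigma>\<close> and the extreme values of
  \<open>ore_pi\<close>\<close>

locale ore_data = unital_nonassoc_ring R for R (structure) +
  fixes \<sigma> \<delta> :: "'a \<Rightarrow> 'a"
  assumes auto: "ring_automorphism R \<sigma>"
    and deriv: "sigma_derivation R \<sigma> \<delta>"
begin

abbreviation S where "S \<equiv> ore_extension R \<sigma> \<delta>"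

lemma sigma_closed: "a \<in> carrier R \<Longrightarrow> \<sigma> a \<in> carrier R"
  using auto by (auto simp: ring_automorphism_def ring_endomorphism_def)

lemma delta_closed: "a \<in> carrier R \<Longrightarrow> \<delta> a \<in> carrier R"
  using deriv by (auto simp: sigma_derivation_def)

lemma sigma_pow_bij: "bij_betw (\<sigma> ^^ n) (carrier R) (carrier R)"
  using auto by (simp add: ring_automorphism_def bij_betw_funpow)

lemma sigma_pow_closed: "a \<in> carrier R \<Longrightarrow> (\<sigma> ^^ n) a \<in> carrier R"
  using sigma_pow_bij by (metis bij_betwE)

lemma sigma_pow_add:
  "\<lbrakk>a \<in> carrier R; b \<in> carrier R\<rbrakk> \<Longrightarrow> (\<sigma> ^^ n) (a \<oplus> b) = (\<sigma> ^^ n) a \<oplus> (\<sigma> ^^ n) b"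
  using auto by (induction n) (simp_all add: sigma_pow_closed ring_automorphism_def ring_endomorphism_def)

lemma sigma_pow_mult:
  "\<lbrakk>a \<in> carrier R; b \<in> carrier R\<rbrakk> \<Longrightarrow> (\<sigma> ^^ n) (a \<otimes> b) = (\<sigma> ^^ n) a \<otimes> (\<sigma> ^^ n) b"
  using auto by (induction n) (simp_all add: sigma_pow_closed ring_automorphism_def ring_endomorphism_def)

lemma sigma_pow_zero: "(\<sigma> ^^ n) \<zero> = \<zero>"
  using sigma_pow_add[of \<zero> \<zero> n] by (intro add_idem_zero) (simp_all add: sigma_pow_closed)

lemma sigma_pow_neg:
  assumes "a \<in> carrier R"
  shows "(\<sigma> ^^ n) (\<ominus> a) = \<ominus> (\<sigma> ^^ n) a"
proof -
  have "(\<sigma> ^^ n) (\<ominus> a) \<oplus> (\<sigma> ^^ n) a = \<zero>"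
    using sigma_pow_add[of "\<ominus> a" a n] assms by (simp add: l_neg sigma_pow_zero)
  then show ?thesis
    using assms by (intro minus_equality[symmetric]) (simp_all add: sigma_pow_closed)
qed

lemma sigma_pow_one: "(\<sigma> ^^ n) \<one> = \<one>"
  by (induction n) (simp_all add: ring_automorphism_one[OF auto])

lemma ore_pi_closed:
  assumes "b \<in> carrier R"
  shows "ore_pi R \<sigma> \<delta> m i b \<in> carrier R"
proof -
  have "foldr (\<lambda>s. if s then \<sigma> else \<delta>) w b \<in> carrier R" for w
    by (induction w) (use assms in \<open>auto simp: sigma_closed delta_closed\<close>)
  then show ?thesis
    unfolding ore_pi_def by (intro finsum_closed) auto
qed

text \<open>The word consisting of \<open>m\<close> letters \<open>True\<close> is the only one
  counted, so a single composition remains.\<close>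

lemma ore_pi_top:
  assumes "b \<in> carrier R"
  shows "ore_pi R \<sigma> \<delta> m m b = (\<sigma> ^^ m) b"
proof -
  have "{w :: bool list. length w = m \<and> count_list w True = m} = {replicate m True}"
  proof (intro equalityI subsetI)
    fix w :: "bool list"
    assume "w \<in> {w. length w = m \<and> count_list w True = m}"
    then have "length (filter ((=) True) w) = length w" "length w = m"
      by (simp_all add: count_list_eq_length_filter)
    \<comment> \<open>A filter that preserves the length has discarded no letter.\<close>
    then have "\<forall>x \<in> set w. x = True"
      using length_filter_less[of _ w "(=) True"] by fastforce
    with \<open>length w = m\<close> show "w \<in> {replicate m True}"
      by (auto intro: replicate_eqI)
  qed (simp add: count_list_eq_length_filter)
  moreover have "foldr (\<lambda>s. if s then \<sigma> else \<delta>) (replicate m True) b = (\<sigma> ^^ m) b"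
    by (induction m) simp_all
  ultimately show ?thesis
    using assms sigma_pow_closed by (simp add: ore_pi_def)
qed

text \<open>No word has more letters \<open>True\<close> than letters, so the sum is empty.\<close>

lemma ore_pi_above: "m < i \<Longrightarrow> ore_pi R \<sigma> \<delta> m i b = \<zero>"
proof -
  assume "m < i"
  then have "{w :: bool list. length w = m \<and> count_list w True = i} = {}"
    using count_le_length[of _ True] by (force simp: not_le[symmetric])
  then show ?thesis unfolding ore_pi_def by (simp only: finsum_empty)
qed

section \<open>Degree and leading coefficient of a product\<close>

lemma up_coeff_closed: "p \<in> up R \<Longrightarrow> p n \<in> carrier R"
  by (rule mem_upD)

lemma finsum_eq_single:
  assumes "finite A" "x \<in> carrier R" "j \<in> A" "f j = x" "\<And>i. i \<in> A \<Longrightarrow> i \<noteq> j \<Longrightarrow> f i = \<zero>"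
  shows "finsum R f A = x"
proof -
  have "finsum R f A = (\<Oplus>i\<in>A. if j = i then x else \<zero>)"
    using assms by (intro finsum_cong') auto
  also have "\<dots> = x"
    using assms finsum_singleton[of j A "\<lambda>_. x"] by simp
  finally show ?thesis .
qed

lemma finsum_eq_zero:
  assumes "\<And>i. i \<in> A \<Longrightarrow> f i = \<zero>"
  shows "finsum R f A = \<zero>"
proof -
  have "finsum R f A = (\<Oplus>i\<in>A. \<zero>)"
    using assms by (intro finsum_cong') auto
  then show ?thesis by simp
qed

lemma ore_monom_mult_above:
  assumes "a \<in> carrier R" "m + n < k"
  shows "ore_monom_mult R \<sigma> \<delta> a m b n k = \<zero>"
  using assms by (simp add: ore_monom_mult_def ore_pi_above r_null)

lemma ore_monom_mult_top:
  assumes "b \<in> carrier R"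
  shows "ore_monom_mult R \<sigma> \<delta> a m b n (m + n) = a \<otimes> (\<sigma> ^^ m) b"
  using assms by (simp add: ore_monom_mult_def ore_pi_top)

text \<open>Each pair of indices in the two supports has sum at most \<open>m + n\<close>, and a
  product of monomials has no term beyond the sum of their degrees.\<close>

lemma mult_above:
  assumes p: "p \<in> up R" "\<And>i. i > m \<Longrightarrow> p i = \<zero>"
    and q: "\<And>i. i > n \<Longrightarrow> q i = \<zero>"
    and k: "m + n < k"
  shows "(p \<otimes>\<^bsub>S\<^esub> q) k = \<zero>"
proof -
  have "i + j < k" if "p i \<noteq> \<zero>" "q j \<noteq> \<zero>" for i j
    using p(2)[of i] q[of j] that k by (meson add_mono linorder_not_le order_le_less_trans)
  then show ?thesis
    using p(1) by (auto simp: ore_extension_def ore_monom_mult_above up_coeff_closed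
        intro!: finsum_eq_zero)
qed

text \<open>Among the products of monomials only that of the two top ones can reach degree
  \<open>m + n\<close>; its coefficient there comes from \<open>ore_pi_top\<close>.\<close>

lemma mult_top:
  assumes p: "p \<in> up R" "\<And>i. i > m \<Longrightarrow> p i = \<zero>"
    and q: "q \<in> up R" "\<And>i. i > n \<Longrightarrow> q i = \<zero>"
  shows "(p \<otimes>\<^bsub>S\<^esub> q) (m + n) = p m \<otimes> (\<sigma> ^^ m) (q n)"
proof -
  let ?A = "{i. p i \<noteq> \<zero>}" and ?B = "{j. q j \<noteq> \<zero>}"
  let ?f = "\<lambda>i j. ore_monom_mult R \<sigma> \<delta> (p i) i (q j) j (m + n)"
  have A: "?A \<subseteq> {..m}" and B: "?B \<subseteq> {..n}"
    using p(2) q(2) by (auto simp: not_less[symmetric])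
  have fin: "finite ?A" "finite ?B"
    using A B finite_subset by blast+
  have zero: "?f i j = \<zero>" if "i \<in> ?A" "j \<in> ?B" "i \<noteq> m \<or> j \<noteq> n" for i j
  proof -
    have "i \<le> m" "j \<le> n" using A B that by auto
    then show ?thesis
      using that p(1) by (intro ore_monom_mult_above up_coeff_closed) auto
  qed
  have top: "?f m n = p m \<otimes> (\<sigma> ^^ m) (q n)"
    using q(1) by (simp add: ore_monom_mult_top up_coeff_closed)
  have closed: "p m \<otimes> (\<sigma> ^^ m) (q n) \<in> carrier R"
    using p(1) q(1) by (simp add: m_closed sigma_pow_closed up_coeff_closed)
  have eq: "(p \<otimes>\<^bsub>S\<^esub> q) (m + n) = (\<Oplus>i\<in>?A. \<Oplus>j\<in>?B. ?f i j)"
    by (simp add: ore_extension_def)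
  show ?thesis
  proof (cases "m \<in> ?A \<and> n \<in> ?B")
    case True
    show ?thesis
      unfolding eq
    proof (rule finsum_eq_single[where j = m])
      show "(\<Oplus>j\<in>?B. ?f m j) = p m \<otimes> (\<sigma> ^^ m) (q n)"
        using fin closed True top zero by (intro finsum_eq_single[where j = n]) auto
    qed (use fin closed True zero in \<open>auto intro!: finsum_eq_zero\<close>)
  next
    \<comment> \<open>As \<open>m\<close> and \<open>n\<close> are mere degree bounds,
      \<open>p m\<close> or \<open>q n\<close> may vanish. The pair \<open>(m, n)\<close> is then
      missing from the sum over the supports, and both sides are zero.\<close>
    case False
    have "(p \<otimes>\<^bsub>S\<^esub> q) (m + n) = \<zero>"
      unfolding eq using False by (intro finsum_eq_zero zero) auto
    moreover have "p m \<otimes> (\<sigma> ^^ m) (q n) = \<zero>"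
    proof (cases "q n = \<zero>")
      case True
      then show ?thesis using p(1) by (simp add: sigma_pow_zero r_null up_coeff_closed)
    next
      case q: False
      with False have "p m = \<zero>" by simp
      then show ?thesis
        using \<open>q \<in> up R\<close> by (simp add: l_null sigma_pow_closed up_coeff_closed)
    qed
    ultimately show ?thesis by simp
  qed
qed

section \<open>The additive group of the Ore extension\<close>

lemma monom_in_up: "a \<in> carrier R \<Longrightarrow> (\<lambda>i. if i = n then a else \<zero>) \<in> up R"
  by (intro mem_upI exI[of _ n] bound.intro) auto

lemma add_coeff: "(p \<oplus>\<^bsub>S\<^esub> q) k = p k \<oplus> q k"
  by (simp add: ore_extension_def)

lemma zero_coeff: "\<zero>\<^bsub>S\<^esub> k = \<zero>"
  by (simp add: ore_extension_def)

lemma carrier_S: "carrier S = up R"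
  by (simp add: ore_extension_def)

text \<open>Serves to identify negatives in \<open>S\<close>, which the record determines only
  through addition and zero, with coefficientwise negatives.\<close>

lemma abelian_group_S: "abelian_group S"
proof (rule abelian_groupI)
  fix p q assume p: "p \<in> carrier S" and q: "q \<in> carrier S"
  then obtain m n where "bound \<zero> m p" "bound \<zero> n q"
    by (auto simp: carrier_S up_def)
  then have "bound \<zero> (max m n) (p \<oplus>\<^bsub>S\<^esub> q)"
    by (auto simp: bound_def add_coeff)
  with p q show "p \<oplus>\<^bsub>S\<^esub> q \<in> carrier S"
    by (auto simp: carrier_S add_coeff up_coeff_closed intro!: mem_upI)
  from p q show "p \<oplus>\<^bsub>S\<^esub> q = q \<oplus>\<^bsub>S\<^esub> p"
    by (auto simp: carrier_S add_coeff up_coeff_closed a_comm)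
next
  show "\<zero>\<^bsub>S\<^esub> \<in> carrier S"
    by (auto simp: carrier_S zero_coeff bound_def intro!: mem_upI)
next
  fix p q r assume "p \<in> carrier S" "q \<in> carrier S" "r \<in> carrier S"
  then show "p \<oplus>\<^bsub>S\<^esub> q \<oplus>\<^bsub>S\<^esub> r = p \<oplus>\<^bsub>S\<^esub> (q \<oplus>\<^bsub>S\<^esub> r)"
    by (auto simp: carrier_S add_coeff up_coeff_closed a_assoc)
next
  fix p assume p: "p \<in> carrier S"
  then show "\<zero>\<^bsub>S\<^esub> \<oplus>\<^bsub>S\<^esub> p = p"
    by (auto simp: carrier_S add_coeff zero_coeff up_coeff_closed)
  from p obtain n where "bound \<zero> n p"
    by (auto simp: carrier_S up_def)
  with p show "\<exists>q \<in> carrier S. q \<oplus>\<^bsub>S\<^esub> p = \<zero>\<^bsub>S\<^esub>"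
    by (intro bexI[of _ "\<lambda>i. \<ominus> p i"])
      (auto simp: carrier_S add_coeff zero_coeff up_coeff_closed l_neg bound_def
        intro!: mem_upI exI[of _ n])
qed

section \<open>Additive subgroups and their leading coefficients\<close>

context
  fixes I assumes I: "additive_subgroup I S"
begin

lemma in_up: "p \<in> I \<Longrightarrow> p \<in> up R"
  using additive_subgroup.a_Hcarr[OF I] by (simp add: carrier_S)

lemma zero_in: "(\<lambda>_. \<zero>) \<in> I"
  using additive_subgroup.zero_closed[OF I] by (simp add: ore_extension_def)

lemma add_in: "\<lbrakk>p \<in> I; q \<in> I\<rbrakk> \<Longrightarrow> (\<lambda>k. p k \<oplus> q k) \<in> I"
  using additive_subgroup.a_closed[OF I, of p q] by (simp add: ore_extension_def)

lemma neg_in: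
  assumes "p \<in> I"
  shows "(\<lambda>k. \<ominus> p k) \<in> I"
proof -
  interpret S: abelian_group S by (rule abelian_group_S)
  have p: "p \<in> carrier S" and np: "\<ominus>\<^bsub>S\<^esub> p \<in> I"
    using assms additive_subgroup.a_Hcarr[OF I] additive_subgroup.a_inv_closed[OF I] by auto
  have "(\<ominus>\<^bsub>S\<^esub> p) k = \<ominus> p k" for k
  proof -
    \<comment> \<open>The inverse law of \<open>S\<close> is read off at the coefficient
      \<open>k\<close>; uniqueness of inverses in \<open>R\<close> then applies.\<close>
    have "(\<ominus>\<^bsub>S\<^esub> p) k \<oplus> p k = \<zero>"
      using S.l_neg[OF p] by (metis add_coeff zero_coeff)
    then show ?thesis
      using np assms by (metis in_up minus_equality up_coeff_closed)
  qed
  then have "\<ominus>\<^bsub>S\<^esub> p = (\<lambda>k. \<ominus> p k)" ..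
  with np show ?thesis by simp
qed

lemma leading_coeffs_subset: "leading_coeffs R I n \<subseteq> carrier R"
  by (auto simp: leading_coeffs_def in_up up_coeff_closed)

lemma leading_coeffs_zero: "\<zero> \<in> leading_coeffs R I n"
  using zero_in by (auto simp: leading_coeffs_def intro: exI[of _ "\<lambda>_. \<zero>"])

lemma leading_coeffs_add:
  assumes "a \<in> leading_coeffs R I n" "b \<in> leading_coeffs R I n"
  shows "a \<oplus> b \<in> leading_coeffs R I n"
proof -
  obtain p q where "p \<in> I" "\<forall>m>n. p m = \<zero>" "a = p n" "q \<in> I" "\<forall>m>n. q m = \<zero>" "b = q n"
    using assms by (auto simp: leading_coeffs_def)
  then show ?thesis
    by (auto simp: leading_coeffs_def intro!: exI[of _ "\<lambda>k. p k \<oplus> q k"] add_in)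
qed

lemma leading_coeffs_neg:
  assumes "a \<in> leading_coeffs R I n"
  shows "\<ominus> a \<in> leading_coeffs R I n"
proof -
  obtain p where "p \<in> I" "\<forall>m>n. p m = \<zero>" "a = p n"
    using assms by (auto simp: leading_coeffs_def)
  then show ?thesis
    by (auto simp: leading_coeffs_def intro!: exI[of _ "\<lambda>k. \<ominus> p k"] neg_in)
qed

end

text \<open>Subtracting from an element of \<open>J\<close> an element of \<open>I\<close> with the
  same leading coefficient lowers the degree, and the difference stays in \<open>J\<close> because
  \<open>I\<close> lies in \<open>J\<close>. Induction on a degree bound concludes.\<close>

lemma eq_if_leading_coeffs_eq:
  assumes I: "additive_subgroup I S" and J: "additive_subgroup J S" and sub: "I \<subseteq> J"
    and eq: "\<And>n. leading_coeffs R I n = leading_coeffs R J n"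
  shows "I = J"
proof -
  \<comment> \<open>The bound \<open>n\<close> is strict, so that the base case \<open>n = 0\<close>
    is exactly the zero polynomial.\<close>
  have "p \<in> I" if "p \<in> J" "\<And>m. m \<ge> n \<Longrightarrow> p m = \<zero>" for p n
    using that
  proof (induction n arbitrary: p)
    case 0
    then have "p = (\<lambda>_. \<zero>)" by auto
    then show ?case using zero_in[OF I] by simp
  next
    case (Suc n)
    then have "p n \<in> leading_coeffs R I n"
      unfolding eq by (auto simp: leading_coeffs_def)
    \<comment> \<open>After rewriting with \<open>eq\<close> the witness comes from
      \<open>I\<close>, although \<open>p\<close> is only known to lie in \<open>J\<close>.\<close>
    then obtain q where q: "q \<in> I" "\<forall>m>n. q m = \<zero>" "q n = p n"
      by (auto simp: leading_coeffs_def)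
    define r where "r = (\<lambda>k. p k \<oplus> \<ominus> q k)"
    have pq: "p k \<in> carrier R" "q k \<in> carrier R" for k
      using in_up[OF J Suc.prems(1)] in_up[OF I q(1)] up_coeff_closed by auto
    have "r \<in> I"
    proof (rule Suc.IH)
      show "r \<in> J"
        unfolding r_def using Suc.prems(1) q(1) sub by (intro add_in[OF J] neg_in[OF J]) auto
      show "r m = \<zero>" if "n \<le> m" for m
        using that q Suc.prems(2)[of m] pq by (cases "m = n") (auto simp: r_def r_neg)
    qed
    then have "(\<lambda>k. r k \<oplus> q k) \<in> I"
      using q(1) by (intro add_in[OF I])
    moreover have "(\<lambda>k. r k \<oplus> q k) = p"
      using pq by (auto simp: r_def a_assoc l_neg)
    ultimately show ?case by simp
  qed
  moreover have "\<exists>n. \<forall>m\<ge>n. p m = \<zero>" if "p \<in> J" for p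
    using in_up[OF J that] by (auto simp: up_def bound_def) (metis Suc_le_lessD)
  ultimately show ?thesis using sub by blast
qed

section \<open>Ideals of \<open>R\<close> formed by leading coefficients\<close>

lemma additive_subgroupI:
  assumes "A \<subseteq> carrier R" "\<zero> \<in> A" "\<And>a b. a \<in> A \<Longrightarrow> b \<in> A \<Longrightarrow> a \<oplus> b \<in> A"
    "\<And>a. a \<in> A \<Longrightarrow> \<ominus> a \<in> A"
  shows "additive_subgroup A R"
  using assms by (intro additive_subgroup.intro add.subgroupI) (auto simp: a_inv_def)

text \<open>Serves right and left ideals alike: only the product is asked to lie in
  \<open>I\<close>, so either factor may be the one taken from the ideal.\<close>

lemma leading_coeffs_mult:
  assumes p: "p \<in> up R" "\<forall>i>m. p i = \<zero>" and q: "q \<in> up R" "\<forall>i>n. q i = \<zero>"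
    and pq: "p \<otimes>\<^bsub>S\<^esub> q \<in> I"
  shows "p m \<otimes> (\<sigma> ^^ m) (q n) \<in> leading_coeffs R I (m + n)"
proof -
  have "\<forall>k > m + n. (p \<otimes>\<^bsub>S\<^esub> q) k = \<zero>"
    using mult_above[of p m n q] p q by blast
  moreover have "(p \<otimes>\<^bsub>S\<^esub> q) (m + n) = p m \<otimes> (\<sigma> ^^ m) (q n)"
    using mult_top[of p m q n] p q by blast
  ultimately show ?thesis
    unfolding leading_coeffs_def using pq by (intro CollectI exI[of _ "p \<otimes>\<^bsub>S\<^esub> q"]) simp
qed

text \<open>Comes from right multiplication by the monomial with coefficient \<open>b\<close> and
  degree \<open>n\<close>. Degree 0 yields closure under \<open>R\<close>, and
  \<open>b = \<one>\<close> in degree 1 yields growth in the degree.\<close>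

lemma right_ideal_leading_mult:
  assumes I: "right_ideal I S" and a: "a \<in> leading_coeffs R I m" and b: "b \<in> carrier R"
  shows "a \<otimes> (\<sigma> ^^ m) b \<in> leading_coeffs R I (m + n)"
proof -
  obtain p where p: "p \<in> I" "\<forall>i>m. p i = \<zero>" "a = p m"
    using a by (auto simp: leading_coeffs_def)
  let ?q = "\<lambda>i. if i = n then b else \<zero>"
  have "additive_subgroup I S" "p \<otimes>\<^bsub>S\<^esub> ?q \<in> I"
    using I p(1) monom_in_up[OF b] by (auto simp: right_ideal_def carrier_S)
  then show ?thesis
    using leading_coeffs_mult[of p m ?q n I] p monom_in_up[OF b] in_up by auto
qed

text \<open>Here the monomial stands on the left, so the twist by \<open>\<sigma> ^^ m\<close> falls
  on the coefficient from the ideal.\<close>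

lemma left_ideal_leading_mult:
  assumes I: "left_ideal I S" and a: "a \<in> leading_coeffs R I n" and b: "b \<in> carrier R"
  shows "b \<otimes> (\<sigma> ^^ m) a \<in> leading_coeffs R I (m + n)"
proof -
  obtain p where p: "p \<in> I" "\<forall>i>n. p i = \<zero>" "a = p n"
    using a by (auto simp: leading_coeffs_def)
  let ?q = "\<lambda>i. if i = m then b else \<zero>"
  have "additive_subgroup I S" "?q \<otimes>\<^bsub>S\<^esub> p \<in> I"
    using I p(1) monom_in_up[OF b] by (auto simp: left_ideal_def carrier_S)
  then show ?thesis
    using leading_coeffs_mult[of ?q m p n I] p monom_in_up[OF b] in_up by auto
qed

lemma right_ideal_leading_coeffs:
  assumes I: "right_ideal I S"
  shows "right_ideal (leading_coeffs R I n) R"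
proof -
  have sub: "additive_subgroup I S" using I by (simp add: right_ideal_def)
  have "a \<otimes> s \<in> leading_coeffs R I n" if a: "a \<in> leading_coeffs R I n" and s: "s \<in> carrier R" for a s
  proof -
    \<comment> \<open>Multiplication by constants only produces right factors of the form
      \<open>(\<sigma> ^^ n) b\<close>; surjectivity makes every \<open>s\<close> such a
      factor.\<close>
    obtain b where "b \<in> carrier R" "(\<sigma> ^^ n) b = s"
      using s sigma_pow_bij[of n] by (metis bij_betw_iff_bijections)
    then show ?thesis using right_ideal_leading_mult[OF I a, of b 0] by simp
  qed
  then show ?thesis
    unfolding right_ideal_def
    by (auto intro!: additive_subgroupI leading_coeffs_zero[OF sub] leading_coeffs_add[OF sub]
        leading_coeffs_neg[OF sub] leading_coeffs_subset[OF sub, THEN subsetD])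
qed

lemma right_ideal_leading_coeffs_Suc:
  assumes I: "right_ideal I S"
  shows "leading_coeffs R I n \<subseteq> leading_coeffs R I (Suc n)"
proof
  fix a assume a: "a \<in> leading_coeffs R I n"
  have "a \<in> carrier R"
    using I a leading_coeffs_subset by (auto simp: right_ideal_def)
  then show "a \<in> leading_coeffs R I (Suc n)"
    \<comment> \<open>Right multiplication by X keeps the leading coefficient, since powers of
      \<open>\<sigma>\<close> fix \<open>\<one>\<close>.\<close>
    using right_ideal_leading_mult[OF I a one_closed, of 1] by (simp add: sigma_pow_one r_one)
qed

text \<open>Left multiplication by X turns a leading coefficient \<open>a\<close> into
  \<open>\<sigma> a\<close>, which need not be \<open>a\<close>. Pulling back along
  \<open>\<sigma> ^^ n\<close> absorbs this shift and makes the sets increase with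
  \<open>n\<close>.\<close>

definition twisted_leading_coeffs :: "(nat \<Rightarrow> 'a) set \<Rightarrow> nat \<Rightarrow> 'a set"
  where "twisted_leading_coeffs I n = {a \<in> carrier R. (\<sigma> ^^ n) a \<in> leading_coeffs R I n}"

lemma left_ideal_twisted_leading_coeffs:
  assumes I: "left_ideal I S"
  shows "left_ideal (twisted_leading_coeffs I n) R"
proof -
  have sub: "additive_subgroup I S" using I by (simp add: left_ideal_def)
  have "additive_subgroup (twisted_leading_coeffs I n) R"
    by (intro additive_subgroupI)
      (auto simp: twisted_leading_coeffs_def sigma_pow_zero sigma_pow_add sigma_pow_neg
        leading_coeffs_zero[OF sub] leading_coeffs_add[OF sub] leading_coeffs_neg[OF sub])
  moreover have "s \<otimes> a \<in> twisted_leading_coeffs I n"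
    if "a \<in> twisted_leading_coeffs I n" "s \<in> carrier R" for a s
    \<comment> \<open>The constant \<open>(\<sigma> ^^ n) s\<close> is chosen so that its product
      with \<open>(\<sigma> ^^ n) a\<close> is the image of \<open>s \<otimes> a\<close>.\<close>
    using that left_ideal_leading_mult[OF I, of "(\<sigma> ^^ n) a" n "(\<sigma> ^^ n) s" 0]
    by (simp add: twisted_leading_coeffs_def m_closed sigma_pow_mult sigma_pow_closed)
  ultimately show ?thesis by (simp add: left_ideal_def)
qed

lemma left_ideal_twisted_leading_coeffs_Suc:
  assumes I: "left_ideal I S"
  shows "twisted_leading_coeffs I n \<subseteq> twisted_leading_coeffs I (Suc n)"
proof
  fix a assume a: "a \<in> twisted_leading_coeffs I n"
  then show "a \<in> twisted_leading_coeffs I (Suc n)"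
    using left_ideal_leading_mult[OF I _ one_closed, of "(\<sigma> ^^ n) a" n 1]
    by (simp add: twisted_leading_coeffs_def l_one sigma_closed sigma_pow_closed)
qed

text \<open>Carries equality of the twisted sets back to the untwisted ones; surjectivity of
  \<open>\<sigma> ^^ n\<close> ensures that the pullback loses nothing.\<close>

lemma leading_coeffs_eq_image:
  assumes "additive_subgroup I S"
  shows "leading_coeffs R I n = (\<sigma> ^^ n) ` twisted_leading_coeffs I n"
  using leading_coeffs_subset[OF assms, of n] sigma_pow_bij[of n]
  by (auto simp: twisted_leading_coeffs_def bij_betw_def)

section \<open>Transfer of the chain conditions\<close>

lemma right_noetherian_ore_extension:
  assumes "right_noetherian R"
  shows "right_noetherian S"
  unfolding right_noetherian_def
proof (intro allI impI)
  fix C :: "nat \<Rightarrow> (nat \<Rightarrow> 'a) set"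
  assume "(\<forall>n. right_ideal (C n) S) \<and> (\<forall>n. C n \<subseteq> C (Suc n))"
  then have C: "\<And>n. right_ideal (C n) S" and step: "\<And>n. C n \<subseteq> C (Suc n)" by auto
  \<comment> \<open>The index \<open>k\<close> follows the chain and \<open>n\<close> the degree.
    One \<open>N\<close> must serve all degrees, since comparing two ideals involves every
    \<open>n\<close>.\<close>
  have "\<exists>N. \<forall>k \<ge> N. \<forall>n. leading_coeffs R (C k) n = leading_coeffs R (C N) n"
    using assms C step
    by (intro double_chain_stabilises[where P = "\<lambda>A. right_ideal A R"] right_ideal_leading_coeffs
        right_ideal_leading_coeffs_Suc leading_coeffs_mono) (auto simp: right_noetherian_def)
  then obtain N where N: "\<And>k n. k \<ge> N \<Longrightarrow> leading_coeffs R (C k) n = leading_coeffs R (C N) n"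
    by blast
  have "C N = C k" if "k \<ge> N" for k
    using C N[OF that] lift_Suc_mono_le[of C, OF step that]
    by (intro eq_if_leading_coeffs_eq) (auto simp: right_ideal_def)
  then show "\<exists>N. \<forall>n \<ge> N. C n = C N" by metis
qed

lemma left_noetherian_ore_extension:
  assumes "left_noetherian R"
  shows "left_noetherian S"
  unfolding left_noetherian_def
proof (intro allI impI)
  fix C :: "nat \<Rightarrow> (nat \<Rightarrow> 'a) set"
  assume "(\<forall>n. left_ideal (C n) S) \<and> (\<forall>n. C n \<subseteq> C (Suc n))"
  then have C: "\<And>n. left_ideal (C n) S" and step: "\<And>n. C n \<subseteq> C (Suc n)" by auto
  have sub: "additive_subgroup (C n) S" for n
    using C by (simp add: left_ideal_def)
  have mono: "twisted_leading_coeffs (C k) n \<subseteq> twisted_leading_coeffs (C (Suc k)) n" for k n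
    using leading_coeffs_mono[OF step] by (auto simp: twisted_leading_coeffs_def)
  have "\<exists>N. \<forall>k \<ge> N. \<forall>n. twisted_leading_coeffs (C k) n = twisted_leading_coeffs (C N) n"
    using assms C mono
    by (intro double_chain_stabilises[where P = "\<lambda>A. left_ideal A R"]
        left_ideal_twisted_leading_coeffs left_ideal_twisted_leading_coeffs_Suc)
      (auto simp: left_noetherian_def)
  then obtain N where N: "\<And>k n. k \<ge> N \<Longrightarrow>
      twisted_leading_coeffs (C k) n = twisted_leading_coeffs (C N) n"
    by blast
  have "C N = C k" if "k \<ge> N" for k
    using N[OF that] lift_Suc_mono_le[of C, OF step that]
    by (intro eq_if_leading_coeffs_eq sub) (auto simp: leading_coeffs_eq_image[OF sub])
  then show "\<exists>N. \<forall>n \<ge> N. C n = C N" by metis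
qed

end

theorem corollary7:
  fixes R :: "('a, 'm) ring_scheme" and \<sigma> \<delta> :: "'a \<Rightarrow> 'a"
  assumes "unital_nonassoc_ring R"
    and "ring_automorphism R \<sigma>"
    and "sigma_derivation R \<sigma> \<delta>"
  shows "(right_noetherian R \<longrightarrow> right_noetherian (ore_extension R \<sigma> \<delta>)) \<and>
    (left_noetherian R \<longrightarrow> left_noetherian (ore_extension R \<sigma> \<delta>))"
proof -
  interpret ore_data R \<sigma> \<delta>
    using assms by (intro ore_data.intro ore_data_axioms.intro)
  show ?thesis
    using right_noetherian_ore_extension left_noetherian_ore_extension by blast
qed

end
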